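(* Let $G_1=(V_1,E_1)$ and $G_2=(V_2,E_2)$ be graphs, let $v_1\in V_1$, $v_2\in V_2$, and let $P_4=(\{a,b,c,d\},\{ab,bc,cd\})$, where $G_1,G_2,P_4$ are pairwise disjoint. Then the following assertions are true. (i) $I(L_1;x)=I(L_2;x)$, where $L_1=(P_4;b)\ominus(G_1;v_1)$, while $L_2$ has $V(L_2)=V(L_1)$ and $E(L_2)=(E(L_1)\cup\{ac\})-\{cd\}$. If $G_1$ is claw-free and $v_1$ is simplicial in $G_1$, then $I(L_1;x)$ is unimodal. (ii) $I(G;x)=I(H;x)$, where $G=(G_3;c)\ominus(G_2;v_2)$ and $G_3=(G_1;v_1)\ominus(P_4;b)$, while $H$ has $V(H)=V(G)$ and $E(H)=(E(G)\cup\{ac\})-\{cd\}$. If $G_1,G_2$ are claw-free and $v_1,v_2$ are simplicial in $G_1,G_2$, respectively, then $I(G;x)$ is unimodal.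
   Context: All graphs are finite, undirected, without loops or multiple edges. A stable set of a graph $G$ is a set of pairwise non-adjacent vertices; $\alpha(G)$ is the maximum size of a stable set. If $s_k$ is the number of stable sets of size $k$ in $G$ (with $s_0=1$), the independence polynomial of $G$ is $I(G;x)=\sum_{k=0}^{\alpha(G)}s_kx^k$. A polynomial with non-negative real coefficients $a_0,\dots,a_N$ is unimodal if there is $k\in\{0,\dots,N\}$ with $a_0\le\dots\le a_k\ge a_{k+1}\ge\dots\ge a_N$. For disjoint graphs $A,B$ and vertices $p\in V(A)$, $q\in V(B)$, the edge-join $(A;p)\ominus(B;q)$ is obtained from the disjoint union of $A$ and $B$ by adding the edge $pq$. A vertex is simplicial if its neighborhood induces a complete graph. A graph is claw-free if it has no induced subgraph isomorphic to $K_{1,3}$. *)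

theory Defs
  imports Complex_Main "HOL-Computational_Algebra.Polynomial"
begin

type_synonym 'a graph = "'a set \<times> 'a set set"

abbreviation verts :: "'a graph \<Rightarrow> 'a set" where
  "verts G \<equiv> fst G"

abbreviation edges :: "'a graph \<Rightarrow> 'a set set" where
  "edges G \<equiv> snd G"

definition finite_graph :: "'a graph \<Rightarrow> bool" where
  "finite_graph G \<longleftrightarrow> finite (verts G) \<and> (\<forall>e\<in>edges G. e \<subseteq> verts G \<and> card e = 2)"

definition stable_set :: "'a graph \<Rightarrow> 'a set \<Rightarrow> bool" where
  "stable_set G S \<longleftrightarrow> S \<subseteq> verts G \<and> (\<forall>u\<in>S. \<forall>v\<in>S. u \<noteq> v \<longrightarrow> {u, v} \<notin> edges G)"

definition stability_number :: "'a graph \<Rightarrow> nat" where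
  "stability_number G = Max {card S | S. stable_set G S}"

definition num_stable :: "'a graph \<Rightarrow> nat \<Rightarrow> nat" where
  "num_stable G k = card {S. stable_set G S \<and> card S = k}"

definition indep_poly :: "'a graph \<Rightarrow> real poly" where
  "indep_poly G = (\<Sum>k = 0..stability_number G. monom (real (num_stable G k)) k)"

definition unimodal :: "real poly \<Rightarrow> bool" where
  "unimodal p \<longleftrightarrow> (\<forall>i. 0 \<le> coeff p i) \<and>
     (\<exists>k\<le>degree p. (\<forall>i<k. coeff p i \<le> coeff p (Suc i)) \<and>
        (\<forall>i. k \<le> i \<and> i < degree p \<longrightarrow> coeff p (Suc i) \<le> coeff p i))"

text \<open>Meaningful only for graphs with disjoint vertex sets and \<open>p \<in> verts A\<close>,
  \<open>q \<in> verts B\<close>; then the union below is the disjoint union.\<close>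

definition edge_join :: "'a graph \<Rightarrow> 'a \<Rightarrow> 'a graph \<Rightarrow> 'a \<Rightarrow> 'a graph" where
  "edge_join A p B q = (verts A \<union> verts B, edges A \<union> edges B \<union> {{p, q}})"

definition induced_subgraph :: "'a graph \<Rightarrow> 'a set \<Rightarrow> 'a graph" where
  "induced_subgraph G U = (U, {e \<in> edges G. e \<subseteq> U})"

definition complete_graph :: "'a graph \<Rightarrow> bool" where
  "complete_graph G \<longleftrightarrow> edges G = {{u, v} | u v. u \<in> verts G \<and> v \<in> verts G \<and> u \<noteq> v}"

definition neighborhood :: "'a graph \<Rightarrow> 'a \<Rightarrow> 'a set" where
  "neighborhood G v = {u \<in> verts G. {u, v} \<in> edges G}"

definition simplicial :: "'a graph \<Rightarrow> 'a \<Rightarrow> bool" where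
  "simplicial G v \<longleftrightarrow> v \<in> verts G \<and> complete_graph (induced_subgraph G (neighborhood G v))"

definition graph_iso :: "'a graph \<Rightarrow> 'b graph \<Rightarrow> bool" where
  "graph_iso G H \<longleftrightarrow> (\<exists>f. bij_betw f (verts G) (verts H) \<and>
     (\<forall>u\<in>verts G. \<forall>v\<in>verts G. {u, v} \<in> edges G \<longleftrightarrow> {f u, f v} \<in> edges H))"

definition claw :: "nat graph" where
  "claw = ({0, 1, 2, 3}, {{0, 1}, {0, 2}, {0, 3}})"

definition claw_free :: "'a graph \<Rightarrow> bool" where
  "claw_free G \<longleftrightarrow> \<not> (\<exists>U. U \<subseteq> verts G \<and> graph_iso (induced_subgraph G U) claw)"

end

theory Submission
  imports Defs "HOL-Combinatorics.Transposition"
begin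

text \<open>
  The two equalities are instances of one observation (\<open>indep_poly_move_pendant\<close>). Deleting the
  edge \<open>cd\<close> and adding \<open>ac\<close> exchanges the situations of \<open>a\<close> and \<open>d\<close> for the stable sets that
  contain \<open>c\<close>: before, such a set avoids \<open>b\<close> and \<open>d\<close> and is free to contain \<open>a\<close>; afterwards, it
  avoids \<open>b\<close> and \<open>a\<close> and is free to contain \<open>d\<close>. Stable sets without \<open>c\<close> do not see the change.
  So swapping \<open>a\<close> and \<open>d\<close> in the sets that contain \<open>c\<close> is a size-preserving bijection.

  The point of the change is that it destroys the claws centered at \<open>b\<close> and \<open>c\<close>. In \<open>L2\<close> and \<open>H\<close>
  the path has become the triangle \<open>abc\<close> with an isolated vertex \<open>d\<close>, in which every vertex is
  simplicial; and an edge between simplicial vertices of two claw-free graphs creates no claw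
  (\<open>claw_free_edge_join\<close>), because the neighborhood of an endpoint is then a clique and one more
  vertex. As \<open>c\<close> stays simplicial after \<open>G1\<close> is attached at \<open>b\<close>, this applies twice to yield \<open>H\<close>.

  It remains to show that the independence polynomial of a claw-free graph is unimodal, a theorem
  of Hamidoune. Let \<open>s k\<close> be the number of stable sets of size \<open>k\<close>. These numbers are positive up
  to the stability number, so it is enough to show that they are log-concave, which means
  \<open>s k * s (k + 2) \<le> s (k + 1) * s (k + 1)\<close> (\<open>claw_free_log_concave\<close>). Both sides count pairs
  \<open>(A, B)\<close> of stable sets, and the inequality already holds for the pairs with given \<open>A \<inter> B\<close> and
  \<open>A \<union> B\<close>. Such a pair amounts to a proper 2-coloring of the graph induced on
  \<open>D = (A \<union> B) - (A \<inter> B)\<close>, with color classes whose sizes differ by \<open>card A - card B\<close>.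

  The 2-colorings of \<open>D\<close> arise by choosing independently one of two colorings of each component.
  In a claw-free graph a vertex has at most two neighbors in a stable set, so a component has at
  most twice as many edges as vertices in its smaller color class. A component with \<open>n\<close> vertices
  has at least \<open>n - 1\<close> edges, so its two color classes differ in size by at most one
  (\<open>connected_bicoloring_balanced\<close>). The total difference is thus a sum of independent signs, and
  its distribution is symmetric and decreases away from the center (\<open>num_bicolorings_unimodal\<close>): a
  difference of 0 occurs at least as often as a difference of 2.
\<close>

section \<open>Stable sets and the coefficients of the independence polynomial\<close>

lemma stable_setD: "stable_set G S \<Longrightarrow> u \<in> S \<Longrightarrow> v \<in> S \<Longrightarrow> u \<noteq> v \<Longrightarrow> {u, v} \<notin> edges G"
  unfolding stable_set_def by blast

lemma stable_set_subset: "stable_set G S \<Longrightarrow> T \<subseteq> S \<Longrightarrow> stable_set G T"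
  unfolding stable_set_def by blast

lemma finite_stable_set: "finite_graph G \<Longrightarrow> stable_set G S \<Longrightarrow> finite S"
  unfolding stable_set_def finite_graph_def by (blast intro: finite_subset)

lemma finite_stable_sets: "finite_graph G \<Longrightarrow> finite {S. stable_set G S \<and> P S}"
  by (rule finite_subset[of _ "Pow (verts G)"]) (auto simp: stable_set_def finite_graph_def)

lemma no_loop: "finite_graph G \<Longrightarrow> {u, u} \<notin> edges G"
  unfolding finite_graph_def by fastforce

lemma card_stable_le:
  assumes "finite_graph G" "stable_set G S"
  shows "card S \<le> stability_number G"
proof -
  have "finite {card S | S. stable_set G S}"
    using finite_stable_sets[OF assms(1), of "\<lambda>_. True"] by (simp add: setcompr_eq_image)
  then show ?thesis
    unfolding stability_number_def using assms(2) by (intro Max_ge) auto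
qed

lemma num_stable_pos:
  assumes "finite_graph G" "k \<le> stability_number G"
  shows "0 < num_stable G k"
proof -
  have "finite {card S | S. stable_set G S}"
    using finite_stable_sets[OF assms(1), of "\<lambda>_. True"] by (simp add: setcompr_eq_image)
  moreover have "stable_set G {}" by (simp add: stable_set_def)
  ultimately have "stability_number G \<in> {card S | S. stable_set G S}"
    unfolding stability_number_def by (intro Max_in) auto
  then obtain S where S: "stable_set G S" "card S = stability_number G" by auto
  then obtain T where T: "T \<subseteq> S" "card T = k"
    using obtain_subset_with_card_n assms(2) by metis
  have "T \<in> {S. stable_set G S \<and> card S = k}"
    using stable_set_subset[OF S(1) T(1)] T(2) by simp
  then show ?thesis
    unfolding num_stable_def using finite_stable_sets[OF assms(1), of "\<lambda>S. card S = k"]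
    by (auto simp: card_gt_0_iff)
qed

lemma num_stable_eq_0:
  assumes "finite_graph G" "stability_number G < k"
  shows "num_stable G k = 0"
proof -
  have "{S. stable_set G S \<and> card S = k} = {}"
    using card_stable_le[OF assms(1)] assms(2) by force
  then show ?thesis by (simp only: num_stable_def card.empty)
qed

lemma coeff_indep_poly:
  assumes "finite_graph G"
  shows "coeff (indep_poly G) k = real (num_stable G k)"
  using num_stable_eq_0[OF assms, of k]
  by (auto simp: indep_poly_def coeff_sum)

lemma degree_indep_poly:
  assumes "finite_graph G"
  shows "degree (indep_poly G) = stability_number G"
proof (rule antisym)
  show "degree (indep_poly G) \<le> stability_number G"
    by (rule degree_le) (simp add: coeff_indep_poly assms num_stable_eq_0)
  show "stability_number G \<le> degree (indep_poly G)"
    by (rule le_degree) (use num_stable_pos[OF assms] in \<open>simp add: coeff_indep_poly assms\<close>)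
qed

text \<open>
  After the first strict descent the sequence keeps descending: if \<open>s (i + 1) \<le> s i\<close>, then
  \<open>s i * s (i + 2) \<le> s (i + 1) * s (i + 1) \<le> s i * s (i + 1)\<close>, and the positive factor \<open>s i\<close>
  cancels. It is positive because every subset of a stable set is stable.
\<close>

lemma unimodal_indep_poly_if_log_concave:
  assumes G: "finite_graph G"
    and lc: "\<And>k. num_stable G k * num_stable G (k + 2) \<le> (num_stable G (k + 1))\<^sup>2"
  shows "unimodal (indep_poly G)"
proof -
  let ?s = "num_stable G" and ?n = "stability_number G"
  define k where "k = (LEAST k. ?s (Suc k) < ?s k)"
  \<comment> \<open>There is a first strict descent, since the counts vanish above the stability number.\<close>
  have drop: "?s (Suc ?n) < ?s ?n"
    using num_stable_pos[OF G] num_stable_eq_0[OF G] by simp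
  have k: "?s (Suc k) < ?s k"
    unfolding k_def by (rule LeastI[of "\<lambda>k. ?s (Suc k) < ?s k", OF drop])
  have kn: "k \<le> ?n"
    unfolding k_def by (rule Least_le[of "\<lambda>k. ?s (Suc k) < ?s k", OF drop])
  have up: "?s i \<le> ?s (Suc i)" if "i < k" for i
    using not_less_Least[of i "\<lambda>k. ?s (Suc k) < ?s k"] that unfolding k_def by simp
  have down: "i \<le> ?n \<longrightarrow> ?s (Suc i) \<le> ?s i" if "k \<le> i" for i
    using that
  proof (induction i rule: dec_induct)
    case base
    then show ?case using k by simp
  next
    case (step i)
    show ?case
    proof
      assume "Suc i \<le> ?n"
      then have *: "?s (Suc i) \<le> ?s i" "0 < ?s i"
        using step.IH num_stable_pos[OF G] by auto
      have "?s i * ?s (Suc (Suc i)) \<le> ?s (Suc i) * ?s (Suc i)"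
        using lc[of i] by (simp add: power2_eq_square)
      also have "\<dots> \<le> ?s i * ?s (Suc i)"
        using * by simp
      finally show "?s (Suc (Suc i)) \<le> ?s (Suc i)"
        using * by simp
    qed
  qed
  show ?thesis
    unfolding unimodal_def degree_indep_poly[OF G] coeff_indep_poly[OF G]
    using kn up down by auto
qed

section \<open>Claw-freeness through neighborhoods\<close>

text \<open>
  Three elements of \<open>S\<close> would form a claw together with their common neighbor \<open>x\<close>.
\<close>

lemma claw_free_card_le_2:
  assumes G: "finite_graph G" and cf: "claw_free G" and x: "x \<in> verts G"
    and S: "stable_set G S" "S \<subseteq> neighborhood G x"
  shows "card S \<le> 2"
proof (rule ccontr)
  assume "\<not> card S \<le> 2"
  then obtain T where T: "T \<subseteq> S" "card T = 3"
    using obtain_subset_with_card_n[of 3 S] by auto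
  then obtain y1 y2 y3 where y: "T = {y1, y2, y3}" "y1 \<noteq> y2" "y1 \<noteq> y3" "y2 \<noteq> y3"
    by (auto simp: card_3_iff)
  have st: "stable_set G T" using S T stable_set_subset by blast
  have nb: "y1 \<in> verts G" "y2 \<in> verts G" "y3 \<in> verts G"
    "{y1, x} \<in> edges G" "{y2, x} \<in> edges G" "{y3, x} \<in> edges G"
    using S T y by (auto simp: neighborhood_def)
  have nx: "y1 \<noteq> x" "y2 \<noteq> x" "y3 \<noteq> x"
    using nb no_loop[OF G] by auto
  have no: "{y1, y2} \<notin> edges G" "{y1, y3} \<notin> edges G" "{y2, y3} \<notin> edges G"
    using stable_setD[OF st] y by auto
  let ?U = "{x, y1, y2, y3}"
  let ?f = "\<lambda>u. if u = x then 0 else if u = y1 then 1 else if u = y2 then 2 else (3::nat)"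
  have "graph_iso (induced_subgraph G ?U) claw"
    unfolding graph_iso_def
  proof (intro exI[of _ ?f] conjI ballI)
    show "bij_betw ?f (verts (induced_subgraph G ?U)) (verts claw)"
      using nx y by (auto simp: bij_betw_def inj_on_def induced_subgraph_def claw_def)
    fix u v assume "u \<in> verts (induced_subgraph G ?U)" "v \<in> verts (induced_subgraph G ?U)"
    then show "{u, v} \<in> edges (induced_subgraph G ?U) \<longleftrightarrow> {?f u, ?f v} \<in> edges claw"
      using nx y nb no no_loop[OF G]
      by (auto simp: induced_subgraph_def claw_def insert_commute doubleton_eq_iff)
  qed
  moreover have "?U \<subseteq> verts G" using nb x by simp
  ultimately show False
    using cf unfolding claw_free_def by blast
qed

lemma claw_freeI:
  assumes "\<And>x S. x \<in> verts G \<Longrightarrow> stable_set G S \<Longrightarrow> S \<subseteq> neighborhood G x \<Longrightarrow> card S \<le> 2"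
  shows "claw_free G"
  unfolding claw_free_def
proof
  assume "\<exists>U. U \<subseteq> verts G \<and> graph_iso (induced_subgraph G U) claw"
  then obtain U f where U: "U \<subseteq> verts G" and f: "bij_betw f U {0, 1, 2, 3 :: nat}"
    and e: "\<And>u v. u \<in> U \<Longrightarrow> v \<in> U \<Longrightarrow> {u, v} \<in> edges G \<longleftrightarrow> {f u, f v} \<in> edges claw"
    unfolding graph_iso_def induced_subgraph_def
    by (fastforce simp: claw_def)
  obtain x where x: "x \<in> U" "f x = 0"
    using f by (metis bij_betw_imp_surj_on imageE insertI1)
  define S where "S = U - {x}"
  have "card U = 4" using bij_betw_same_card[OF f] by simp
  then have "card S = 3" using x by (simp add: S_def)
  moreover have fS: "f u \<in> {1, 2, 3}" if "u \<in> S" for u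
  proof -
    have "u \<in> U" "u \<noteq> x" using that by (auto simp: S_def)
    then have "f u \<in> {0, 1, 2, 3}" "f u \<noteq> f x"
      using f x(1) unfolding bij_betw_def by (blast, metis inj_onD)
    then show ?thesis using x(2) by simp
  qed
  have "stable_set G S"
    unfolding stable_set_def
  proof (intro conjI ballI impI)
    show "S \<subseteq> verts G" using U by (auto simp: S_def)
    fix u v assume "u \<in> S" "v \<in> S"
    then show "{u, v} \<notin> edges G"
      using e[of u v] fS[of u] fS[of v]
      by (auto simp: S_def claw_def doubleton_eq_iff)
  qed
  moreover have "S \<subseteq> neighborhood G x"
  proof
    fix u assume u: "u \<in> S"
    then show "u \<in> neighborhood G x"
      using e[of u x] fS[of u] U x
      by (auto simp: S_def claw_def neighborhood_def doubleton_eq_iff)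
  qed
  ultimately show False
    using assms[of x S] x U by auto
qed

lemma simplicial_card_le_1:
  assumes "simplicial G v" "stable_set G S" "S \<subseteq> neighborhood G v"
  shows "card S \<le> 1"
proof (rule ccontr)
  assume "\<not> card S \<le> 1"
  then obtain T where "T \<subseteq> S" "card T = 2"
    using obtain_subset_with_card_n[of 2 S] by auto
  then obtain u w where uw: "u \<in> S" "w \<in> S" "u \<noteq> w"
    by (auto simp: card_2_iff)
  let ?N = "neighborhood G v"
  have "edges (induced_subgraph G ?N) = {{u, w} | u w. u \<in> ?N \<and> w \<in> ?N \<and> u \<noteq> w}"
    using assms(1) by (simp add: simplicial_def complete_graph_def induced_subgraph_def)
  then have "{u, w} \<in> edges (induced_subgraph G ?N)"
    using assms(3) uw by blast
  then have "{u, w} \<in> edges G"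
    by (simp add: induced_subgraph_def)
  then show False using assms(2) uw by (auto dest: stable_setD)
qed

lemma edge_join_commute: "edge_join A p B q = edge_join B q A p"
  by (auto simp: edge_join_def)

lemma finite_graph_edge_join:
  assumes "finite_graph A" "finite_graph B" "p \<in> verts A" "q \<in> verts B"
    "verts A \<inter> verts B = {}"
  shows "finite_graph (edge_join A p B q)"
proof -
  have "p \<noteq> q" using assms by auto
  then show ?thesis using assms by (auto simp: finite_graph_def edge_join_def)
qed

text \<open>
  Away from the new edge no neighborhood grows. The neighborhood of \<open>p\<close> gains the vertex \<open>q\<close>, but
  a stable set has at most one vertex in the old neighborhood of \<open>p\<close>, which is a clique.
\<close>

lemma claw_free_edge_join:
  assumes A: "finite_graph A" "claw_free A" "simplicial A p"
    and B: "finite_graph B" "claw_free B" "simplicial B q"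
    and disj: "verts A \<inter> verts B = {}"
  shows "claw_free (edge_join A p B q)"
proof (rule claw_freeI)
  have one_side: "card S \<le> 2"
    if A: "finite_graph A" "claw_free A" "simplicial A p"
      and B: "finite_graph B" "simplicial B q" and disj: "verts A \<inter> verts B = {}"
      and x: "x \<in> verts A" and S: "stable_set (edge_join A p B q) S"
      and nb: "S \<subseteq> neighborhood (edge_join A p B q) x"
    for A B :: "'a graph" and p q x S
  proof -
    have pq: "p \<in> verts A" "q \<in> verts B" using A B by (auto simp: simplicial_def)
    have edge: "e \<subseteq> verts A" if "e \<in> edges A" for e
      using A that by (auto simp: finite_graph_def)
    have edgeB: "e \<subseteq> verts B" if "e \<in> edges B" for e
      using B that by (auto simp: finite_graph_def)
    have N: "neighborhood (edge_join A p B q) x \<subseteq> neighborhood A x \<union> (if x = p then {q} else {})"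
      using x disj edgeB pq edge
      by (force simp: neighborhood_def edge_join_def doubleton_eq_iff)
    have st: "stable_set A (S \<inter> neighborhood A x)"
      using S by (auto simp: stable_set_def edge_join_def neighborhood_def)
    show ?thesis
    proof (cases "x = p")
      case True
      have "finite (neighborhood A x)" using A by (auto simp: finite_graph_def neighborhood_def)
      then have "card S \<le> card (insert q (S \<inter> neighborhood A x))"
        using N nb True by (intro card_mono) auto
      also have "\<dots> \<le> Suc (card (S \<inter> neighborhood A x))"
        by (rule card_insert_le_m1) auto
      also have "\<dots> \<le> 2"
        using simplicial_card_le_1[OF A(3) st] True by auto
      finally show ?thesis .
    next
      case False
      then have "S \<inter> neighborhood A x = S" using N nb by auto
      then show ?thesis using claw_free_card_le_2[OF A(1,2) x st] by auto
    qed
  qed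
  fix x S
  assume x: "x \<in> verts (edge_join A p B q)" and S: "stable_set (edge_join A p B q) S"
      and nb: "S \<subseteq> neighborhood (edge_join A p B q) x"
  from x have "x \<in> verts A \<or> x \<in> verts B" by (auto simp: edge_join_def)
  then show "card S \<le> 2"
  proof
    assume "x \<in> verts A"
    then show ?thesis using one_side[OF A B(1,3) disj _ S nb] by blast
  next
    assume "x \<in> verts B"
    then show ?thesis
      using one_side[OF B A(1,3), of x S] disj S nb
      unfolding edge_join_commute[of A p B q] by blast
  qed
qed

section \<open>Connected sets\<close>

text \<open>
  Connectedness of the graph induced on \<open>C\<close>, expressed by cuts rather than by paths: cuts are what
  the uniqueness of 2-colorings and the bound on the number of edges refer to.
\<close>

definition connected_in :: "'a graph \<Rightarrow> 'a set \<Rightarrow> bool" where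
  "connected_in G C \<longleftrightarrow> C \<noteq> {} \<and>
     (\<forall>S. S \<noteq> {} \<and> S \<subset> C \<longrightarrow> (\<exists>u\<in>S. \<exists>w\<in>C - S. {u, w} \<in> edges G))"

text \<open>
  \<open>C\<close> is a union of components of the graph induced on \<open>D\<close>.
\<close>

definition closed_in :: "'a graph \<Rightarrow> 'a set \<Rightarrow> 'a set \<Rightarrow> bool" where
  "closed_in G D C \<longleftrightarrow> C \<subseteq> D \<and> (\<forall>u\<in>C. \<forall>w\<in>D - C. {u, w} \<notin> edges G)"

text \<open>
  A nonempty closed set of minimal size is connected: a cut of it without edges would give a
  smaller closed set.
\<close>

lemma ex_component:
  assumes "finite D" "D \<noteq> {}"
  shows "\<exists>C. closed_in G D C \<and> connected_in G C"
proof -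
  have "\<exists>C. (closed_in G D C \<and> C \<noteq> {}) \<and> (\<forall>C'. closed_in G D C' \<and> C' \<noteq> {} \<longrightarrow> card C \<le> card C')"
    by (rule ex_has_least_nat[of "\<lambda>C. closed_in G D C \<and> C \<noteq> {}" D])
       (use assms in \<open>auto simp: closed_in_def\<close>)
  then obtain C where C: "closed_in G D C" "C \<noteq> {}"
    and min: "\<And>C'. closed_in G D C' \<Longrightarrow> C' \<noteq> {} \<Longrightarrow> card C \<le> card C'" by blast
  have "connected_in G C"
    unfolding connected_in_def
  proof (intro conjI allI impI C(2))
    fix S assume S: "S \<noteq> {} \<and> S \<subset> C"
    have "finite C" using C assms by (auto simp: closed_in_def intro: finite_subset)
    then have "\<not> closed_in G D S" using S min[of S] psubset_card_mono[of C S] by auto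
    moreover have "S \<subseteq> D" using S C by (auto simp: closed_in_def)
    ultimately obtain u w where uw: "u \<in> S" "w \<in> D - S" "{u, w} \<in> edges G"
      unfolding closed_in_def by blast
    then have "w \<in> C" using S C unfolding closed_in_def by blast
    then show "\<exists>u\<in>S. \<exists>w\<in>C - S. {u, w} \<in> edges G" using uw by blast
  qed
  then show ?thesis using C by blast
qed

text \<open>
  Grow a set inside \<open>C\<close>, vertex by vertex, each time along an edge that leaves it; each new vertex
  brings at least one new edge. The growth is expressed by taking a largest set \<open>S\<close> with
  \<open>card S \<le> card (edges inside S) + 1\<close>.
\<close>

lemma connected_card_le_edges:
  assumes con: "connected_in G C" and fin: "finite C"
  shows "card C \<le> card {e \<in> edges G. e \<subseteq> C} + 1"
proof -
  let ?E = "\<lambda>S. {e \<in> edges G. e \<subseteq> S}"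
  let ?P = "\<lambda>S. S \<noteq> {} \<and> S \<subseteq> C \<and> card S \<le> card (?E S) + 1"
  obtain x where x: "x \<in> C" using con by (auto simp: connected_in_def)
  have "\<exists>S. ?P S \<and> (\<forall>T. ?P T \<longrightarrow> card T \<le> card S)"
    by (rule ex_has_greatest_nat[of ?P "{x}" card "Suc (card C)"])
       (use x fin in \<open>auto intro: card_mono less_Suc_eq_le[THEN iffD2]\<close>)
  then obtain S where S: "S \<noteq> {}" "S \<subseteq> C" "card S \<le> card (?E S) + 1"
    and max: "\<And>T. ?P T \<Longrightarrow> card T \<le> card S" by blast
  have "S = C"
  proof (rule ccontr)
    assume "S \<noteq> C"
    then obtain u w where uw: "u \<in> S" "w \<in> C - S" "{u, w} \<in> edges G"
      using con S unfolding connected_in_def by blast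
    have finS: "finite S" using S fin finite_subset by blast
    have "finite (?E S)" "finite (?E (insert w S))"
      using finS by (auto intro: finite_subset[of _ "Pow (insert w S)"])
    moreover have "{u, w} \<notin> ?E S" using uw by auto
    moreover have "insert {u, w} (?E S) \<subseteq> ?E (insert w S)" using uw by auto
    ultimately have "card (?E S) + 1 \<le> card (?E (insert w S))"
      by (metis (no_types, lifting) Suc_eq_plus1 card_insert_disjoint card_mono)
    then have "?P (insert w S)" using S uw finS by auto
    then show False using max[of "insert w S"] uw finS by auto
  qed
  then show ?thesis using S by simp
qed

section \<open>Bicolorings\<close>

text \<open>
  A proper 2-coloring of the graph induced on \<open>D\<close> is represented by its first color class.
\<close>

definition bicolorings :: "'a graph \<Rightarrow> 'a set \<Rightarrow> 'a set set" where
  "bicolorings G D = {X. X \<subseteq> D \<and> stable_set G X \<and> stable_set G (D - X)}"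

lemma bicolorings_complement: "X \<in> bicolorings G D \<Longrightarrow> D - X \<in> bicolorings G D"
  by (auto simp: bicolorings_def double_diff)

lemma bicolorings_Int:
  assumes "X \<in> bicolorings G D" "C \<subseteq> D"
  shows "X \<inter> C \<in> bicolorings G C"
proof -
  have "C - X \<inter> C \<subseteq> D - X" using assms(2) by auto
  then show ?thesis
    using assms(1) by (auto simp: bicolorings_def intro: stable_set_subset)
qed

lemma finite_bicolorings: "finite D \<Longrightarrow> finite (bicolorings G D)"
  by (rule finite_subset[of _ "Pow D"]) (auto simp: bicolorings_def)

lemma bicoloring_edge:
  "X \<in> bicolorings G D \<Longrightarrow> u \<in> D \<Longrightarrow> v \<in> D \<Longrightarrow> u \<noteq> v \<Longrightarrow> {u, v} \<in> edges G \<Longrightarrow> u \<in> X \<longleftrightarrow> v \<notin> X"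
  unfolding bicolorings_def stable_set_def by blast

text \<open>
  Along an edge both colorings change color, so they agree at one end if and only if they agree at
  the other. Hence no edge leaves the set where they disagree.
\<close>

lemma connected_bicolorings_unique:
  assumes con: "connected_in G C"
    and X: "X \<in> bicolorings G C" and Y: "Y \<in> bicolorings G C"
  shows "Y = X \<or> Y = C - X"
proof -
  have sub: "X \<subseteq> C" "Y \<subseteq> C" using X Y by (auto simp: bicolorings_def)
  define S where "S = (X - Y) \<union> (Y - X)"
  have "\<not> (\<exists>u\<in>S. \<exists>w\<in>C - S. {u, w} \<in> edges G)"
  proof
    assume "\<exists>u\<in>S. \<exists>w\<in>C - S. {u, w} \<in> edges G"
    then obtain u w where uw: "u \<in> S" "w \<in> C - S" "{u, w} \<in> edges G" by blast
    then have "u \<in> C" "w \<in> C" "u \<noteq> w" using sub by (auto simp: S_def)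
    then have "u \<in> X \<longleftrightarrow> w \<notin> X" "u \<in> Y \<longleftrightarrow> w \<notin> Y"
      using bicoloring_edge[OF X] bicoloring_edge[OF Y] uw by auto
    then show False using uw by (auto simp: S_def)
  qed
  then have "S = {} \<or> \<not> S \<subset> C" using con unfolding connected_in_def by blast
  then show ?thesis using sub by (auto simp: S_def)
qed

text \<open>
  Every edge inside \<open>C\<close> has exactly one end in \<open>C - X\<close>, and a vertex there has at most two neighbors in the
  stable set \<open>X\<close>.
\<close>

lemma edges_le_twice_color_class:
  assumes G: "finite_graph G" and cf: "claw_free G" and X: "X \<in> bicolorings G C"
  shows "card {e \<in> edges G. e \<subseteq> C} \<le> 2 * card (C - X)"
proof -
  have stX: "stable_set G X" and stY: "stable_set G (C - X)" and XC: "X \<subseteq> C"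
    using X by (auto simp: bicolorings_def)
  have fin: "finite (C - X)" using finite_stable_set[OF G stY] .
  have finX: "finite X" using finite_stable_set[OF G stX] .
  let ?N = "\<lambda>y. X \<inter> neighborhood G y"
  have "{e \<in> edges G. e \<subseteq> C} \<subseteq> (\<Union>y\<in>C - X. (\<lambda>x. {x, y}) ` ?N y)"
  proof
    fix e assume e: "e \<in> {e \<in> edges G. e \<subseteq> C}"
    then have "card e = 2" using G by (auto simp: finite_graph_def)
    then obtain u v where uv: "e = {u, v}" "u \<noteq> v" by (auto simp: card_2_iff)
    have V: "u \<in> verts G" "v \<in> verts G" using e uv G by (auto simp: finite_graph_def)
    have *: "u \<in> X \<longleftrightarrow> v \<notin> X" using bicoloring_edge[OF X] e uv by auto
    show "e \<in> (\<Union>y\<in>C - X. (\<lambda>x. {x, y}) ` ?N y)"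
    proof (cases "u \<in> X")
      case True
      then show ?thesis using e uv V * by (auto simp: neighborhood_def)
    next
      case False
      then have "v \<in> ?N u" "e = {v, u}" "u \<in> C - X"
        using e uv V * by (auto simp: neighborhood_def insert_commute)
      then show ?thesis by blast
    qed
  qed
  then have "card {e \<in> edges G. e \<subseteq> C} \<le> card (\<Union>y\<in>C - X. (\<lambda>x. {x, y}) ` ?N y)"
    using fin finX by (intro card_mono) auto
  also have "\<dots> \<le> (\<Sum>y\<in>C - X. card ((\<lambda>x. {x, y}) ` ?N y))"
    using fin by (rule card_UN_le)
  also have "\<dots> \<le> (\<Sum>y\<in>C - X. 2)"
  proof (rule sum_mono)
    fix y assume "y \<in> C - X"
    then have "y \<in> verts G" using stY by (auto simp: stable_set_def)
    moreover have "stable_set G (?N y)" using stX by (rule stable_set_subset) auto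
    ultimately have "card (?N y) \<le> 2" using claw_free_card_le_2[OF G cf] by blast
    then show "card ((\<lambda>x. {x, y}) ` ?N y) \<le> 2"
      using card_image_le[of "?N y" "\<lambda>x. {x, y}"] finX by auto
  qed
  finally show ?thesis by simp
qed

text \<open>
  With \<open>n\<close> the size of \<open>C\<close> and \<open>m\<close> the number of its edges, \<open>n - 1 \<le> m\<close> by connectedness, and
  \<open>m\<close> is at most twice the size of either color class. As \<open>n\<close> is the sum of the two sizes, neither
  can exceed the other by more than one.
\<close>

lemma connected_bicoloring_balanced:
  assumes G: "finite_graph G" and cf: "claw_free G" and con: "connected_in G C"
    and X: "X \<in> bicolorings G C"
  shows "\<bar>int (card X) - int (card (C - X))\<bar> \<le> 1"
proof -
  have XC: "X \<subseteq> C" and fin: "finite X" "finite (C - X)"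
    using X finite_stable_set[OF G] by (auto simp: bicolorings_def)
  then have finC: "finite C" using finite_Diff2 by blast
  have "card C = card X + card (C - X)"
    using XC finC by (metis card_Diff_subset card_mono fin(1) le_add_diff_inverse)
  moreover have "card C \<le> 2 * card (C - X) + 1"
    using connected_card_le_edges[OF con finC] edges_le_twice_color_class[OF G cf X] by simp
  moreover have "card C \<le> 2 * card X + 1"
    using connected_card_le_edges[OF con finC]
      edges_le_twice_color_class[OF G cf bicolorings_complement[OF X]] XC
    by (simp add: double_diff)
  ultimately show ?thesis by linarith
qed

definition num_bicolorings :: "'a graph \<Rightarrow> 'a set \<Rightarrow> int \<Rightarrow> nat" where
  "num_bicolorings G D t =
     card {X \<in> bicolorings G D. int (card X) - int (card (D - X)) = t}"

lemma num_bicolorings_uminus: "num_bicolorings G D (- t) = num_bicolorings G D t"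
  unfolding num_bicolorings_def
  by (rule bij_betw_same_card[of "\<lambda>X. D - X"], rule bij_betw_byWitness[where f' = "\<lambda>X. D - X"])
     (auto simp: bicolorings_complement, auto simp: bicolorings_def double_diff)

lemma bicolorings_Un_closed:
  assumes cl: "closed_in G D C"
    and X: "X \<in> bicolorings G C" and Z: "Z \<in> bicolorings G (D - C)"
  shows "X \<union> Z \<in> bicolorings G D"
proof -
  have CD: "C \<subseteq> D" using cl by (simp add: closed_in_def)
  have *: "stable_set G (P \<union> Q)"
    if "stable_set G P" "stable_set G Q" "P \<subseteq> C" "Q \<subseteq> D - C" for P Q
    using that cl unfolding stable_set_def closed_in_def
    by (smt (verit, best) Un_iff insert_commute subset_iff)
  have "D - (X \<union> Z) = (C - X) \<union> (D - C - Z)"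
    using X Z CD by (auto simp: bicolorings_def)
  moreover have "stable_set G ((C - X) \<union> (D - C - Z))"
    using X Z by (intro *) (auto simp: bicolorings_def)
  moreover have "stable_set G (X \<union> Z)"
    using X Z by (intro *) (auto simp: bicolorings_def)
  ultimately show ?thesis using X Z CD by (auto simp: bicolorings_def)
qed

text \<open>
  A coloring of \<open>D\<close> is a coloring of the rest of \<open>D\<close> together with one of the exactly two colorings
  of the component \<open>C\<close>. These contribute the differences \<open>\<delta>\<close> and \<open>- \<delta>\<close>.
\<close>

lemma num_bicolorings_split:
  assumes fin: "finite D"
    and cl: "closed_in G D C" and con: "connected_in G C"
    and X0: "X0 \<in> bicolorings G C"
  defines "\<delta> \<equiv> int (card X0) - int (card (C - X0))"
  shows "num_bicolorings G D t
       = num_bicolorings G (D - C) (t - \<delta>) + num_bicolorings G (D - C) (t + \<delta>)"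
proof -
  let ?F = "\<lambda>D t. {X \<in> bicolorings G D. int (card X) - int (card (D - X)) = t}"
  have CD: "C \<subseteq> D" and X0C: "X0 \<subseteq> C"
    using cl X0 by (auto simp: closed_in_def bicolorings_def)
  have finC: "finite C" using CD fin finite_subset by blast
  have C0: "C \<noteq> {}" using con by (simp add: connected_in_def)
  have Y0: "C - X0 \<in> bicolorings G C" using bicolorings_complement[OF X0] .
  have diff: "int (card (X \<union> Z)) - int (card (D - (X \<union> Z)))
      = (int (card X) - int (card (C - X))) + (int (card Z) - int (card (D - C - Z)))"
    if "X \<subseteq> C" "Z \<subseteq> D - C" for X Z
  proof -
    have "finite X" "finite Z" using that finC fin by (auto intro: finite_subset)
    moreover have "X \<inter> Z = {}" using that by auto
    ultimately have "card (X \<union> Z) = card X + card Z" by (simp add: card_Un_disjoint)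
    moreover have "D - (X \<union> Z) = (C - X) \<union> (D - C - Z)" using that CD by auto
    moreover have "card ((C - X) \<union> (D - C - Z)) = card (C - X) + card (D - C - Z)"
      using finC fin by (intro card_Un_disjoint) auto
    ultimately show ?thesis by simp
  qed
  let ?A = "(\<union>) X0 ` ?F (D - C) (t - \<delta>)" and ?B = "(\<union>) (C - X0) ` ?F (D - C) (t + \<delta>)"
  have dY: "int (card (C - X0)) - int (card (C - (C - X0))) = - \<delta>"
    using X0C by (simp add: \<delta>_def double_diff)
  have dX: "int (card X0) - int (card (C - X0)) = \<delta>" by (simp add: \<delta>_def)
  have "?F D t = ?A \<union> ?B"
  proof (intro equalityI subsetI)
    fix W assume W: "W \<in> ?F D t"
    then have Wb: "W \<in> bicolorings G D" by simp
    have "W - C = W \<inter> (D - C)" using Wb by (auto simp: bicolorings_def)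
    then have Z: "W - C \<in> bicolorings G (D - C)"
      using bicolorings_Int[OF Wb, of "D - C"] by simp
    then have ZD: "W - C \<subseteq> D - C" by (simp add: bicolorings_def)
    have W_split: "W = (W \<inter> C) \<union> (W - C)" by auto
    have "W \<inter> C = X0 \<or> W \<inter> C = C - X0"
      using connected_bicolorings_unique[OF con X0 bicolorings_Int[OF Wb CD]] .
    then show "W \<in> ?A \<union> ?B"
    proof
      assume eq: "W \<inter> C = X0"
      have "W - C \<in> ?F (D - C) (t - \<delta>)"
        using diff[OF X0C ZD] W Z dX W_split unfolding eq by auto
      then show ?thesis using W_split unfolding eq by blast
    next
      assume eq: "W \<inter> C = C - X0"
      have "W - C \<in> ?F (D - C) (t + \<delta>)"
        using diff[OF Diff_subset ZD, of X0] W Z dY W_split unfolding eq by auto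
      then show ?thesis using W_split unfolding eq by blast
    qed
  next
    fix W assume "W \<in> ?A \<union> ?B"
    then show "W \<in> ?F D t"
    proof
      assume "W \<in> ?A"
      then obtain Z where Z: "W = X0 \<union> Z" "Z \<in> ?F (D - C) (t - \<delta>)" by blast
      then have "Z \<subseteq> D - C" by (simp add: bicolorings_def)
      then show ?thesis
        using Z bicolorings_Un_closed[OF cl X0] diff[OF X0C] dX by auto
    next
      assume "W \<in> ?B"
      then obtain Z where Z: "W = (C - X0) \<union> Z" "Z \<in> ?F (D - C) (t + \<delta>)" by blast
      then have "Z \<subseteq> D - C" by (simp add: bicolorings_def)
      then show ?thesis
        using Z bicolorings_Un_closed[OF cl Y0] diff[OF Diff_subset, of Z X0] dY by auto
    qed
  qed
  moreover have "?A \<inter> ?B = {}"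
    using X0C C0 by (auto simp: bicolorings_def)
  moreover have "finite (?F D' s)" if "D' \<subseteq> D" for D' s
    using finite_bicolorings[of D' G] finite_subset[OF that fin] by simp
  moreover have "card ((\<union>) Y ` ?F (D - C) s) = card (?F (D - C) s)" if "Y \<subseteq> C" for Y s
    by (rule card_image) (use that in \<open>auto simp: inj_on_def bicolorings_def\<close>)
  ultimately show ?thesis
    using X0C unfolding num_bicolorings_def by (simp add: card_Un_disjoint)
qed

text \<open>
  Induction on \<open>D\<close> by removing a component. If its classes have equal size, the numbers are doubled.
  Otherwise, with \<open>g\<close> the counts for the rest, the count at \<open>t\<close> is \<open>g (t - 1) + g (t + 1)\<close>, and the
  claim reduces to \<open>g (t + 3) \<le> g (t - 1)\<close>. The bound \<open>-1 \<le> t\<close> covers every step by two that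
  does not approach the center; the step from \<open>-1\<close> to \<open>1\<close> is an equality by symmetry.
\<close>

lemma num_bicolorings_unimodal:
  assumes G: "finite_graph G" and cf: "claw_free G"
  shows "finite D \<Longrightarrow> -1 \<le> t \<Longrightarrow> num_bicolorings G D (t + 2) \<le> num_bicolorings G D t"
proof (induction "card D" arbitrary: D t rule: less_induct)
  case less
  show ?case
  proof (cases "bicolorings G D = {} \<or> D = {}")
    case True
    then have "num_bicolorings G D (t + 2) = 0"
      using less.prems by (auto simp: num_bicolorings_def bicolorings_def)
    then show ?thesis by simp
  next
    case False
    then obtain X where X: "X \<in> bicolorings G D" by auto
    obtain C where C: "closed_in G D C" "connected_in G C"
      using ex_component False less.prems by blast
    then have CD: "C \<subseteq> D" "C \<noteq> {}" by (auto simp: closed_in_def connected_in_def)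
    have XC: "X \<inter> C \<in> bicolorings G C" using bicolorings_Int[OF X CD(1)] .
    define \<delta> where "\<delta> = int (card (X \<inter> C)) - int (card (C - X \<inter> C))"
    let ?g = "num_bicolorings G (D - C)"
    have split: "num_bicolorings G D s = ?g (s - \<delta>) + ?g (s + \<delta>)" for s
      unfolding \<delta>_def by (rule num_bicolorings_split[OF less.prems(1) C XC])
    have "card (D - C) < card D"
      using CD less.prems by (intro psubset_card_mono) auto
    then have IH: "?g (s + 2) \<le> ?g s" if "-1 \<le> s" for s
      using less.hyps less.prems(1) that by blast
    have "\<delta> = 0 \<or> \<delta> = 1 \<or> \<delta> = -1"
      using connected_bicoloring_balanced[OF G cf C(2) XC] unfolding \<delta>_def by linarith
    then have \<delta>: "\<delta> = 0 \<or> (\<forall>s. num_bicolorings G D s = ?g (s - 1) + ?g (s + 1))"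
      using split by auto
    show ?thesis
    proof (cases "\<delta> = 0")
      case True
      then show ?thesis using IH[OF less.prems(2)] by (simp add: split)
    next
      case False
      then have step: "num_bicolorings G D s = ?g (s - 1) + ?g (s + 1)" for s
        using \<delta> by blast
      have "?g (t + 3) \<le> ?g (t - 1)"
      \<comment> \<open>For small \<open>t\<close> the argument \<open>t - 1\<close> is left of the range of the induction hypothesis;
      reflect it.\<close>
      proof (cases "t \<le> 0")
        case True
        have "?g (t - 1) = ?g (1 - t)"
          using num_bicolorings_uminus[of G "D - C" "t - 1"] by simp
        moreover from True less.prems have "t = 0 \<or> t = -1" by linarith
        then have "?g (t + 3) \<le> ?g (1 - t)" using IH[of 1] by auto
        ultimately show ?thesis by simp
      next
        case False
        then show ?thesis using IH[of "t - 1"] IH[of "t + 1"] by (simp add: algebra_simps)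
      qed
      then show ?thesis by (simp add: step algebra_simps)
    qed
  qed
qed

section \<open>Claw-free graphs have log-concave stable set counts\<close>

definition stable_pairs :: "'a graph \<Rightarrow> nat \<Rightarrow> nat \<Rightarrow> ('a set \<times> 'a set) set" where
  "stable_pairs G i j = {(A, B). stable_set G A \<and> stable_set G B \<and> card A = i \<and> card B = j}"

lemma card_stable_pairs: "card (stable_pairs G i j) = num_stable G i * num_stable G j"
proof -
  have "stable_pairs G i j
      = {S. stable_set G S \<and> card S = i} \<times> {S. stable_set G S \<and> card S = j}"
    by (auto simp: stable_pairs_def)
  then show ?thesis by (simp add: num_stable_def card_cartesian_product)
qed

lemma finite_stable_pairs: "finite_graph G \<Longrightarrow> finite (stable_pairs G i j)"
  by (rule finite_subset[of _ "Pow (verts G) \<times> Pow (verts G)"])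
     (auto simp: stable_pairs_def stable_set_def finite_graph_def)

text \<open>
  Removing the intersection \<open>I\<close> turns the pairs into 2-colorings of \<open>D = U - I\<close>. Conversely, as soon
  as one pair of stable sets has intersection \<open>I\<close> and union \<open>U\<close>, no edge joins \<open>I\<close> to \<open>D\<close>, so
  adding \<open>I\<close> to both classes of any coloring of \<open>D\<close> yields a pair of stable sets.
\<close>

lemma card_stable_pairs_fiber_le:
  assumes G: "finite_graph G" and cf: "claw_free G"
  defines "fiber \<equiv> \<lambda>i j I U. {(A, B) \<in> stable_pairs G i j. A \<inter> B = I \<and> A \<union> B = U}"
  shows "card (fiber k (k + 2) I U) \<le> card (fiber (k + 1) (k + 1) I U)"
proof (cases "fiber k (k + 2) I U = {}")
  case False
  then obtain A0 B0 where st0: "stable_set G A0" "stable_set G B0"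
    and c0: "card A0 = k" "card B0 = k + 2" and IU: "A0 \<inter> B0 = I" "A0 \<union> B0 = U"
    by (auto simp: fiber_def stable_pairs_def)
  define D where "D = U - I"
  have fin: "finite A0" "finite B0" using st0 finite_stable_set[OF G] by auto
  then have finD: "finite D" and finI: "finite I" using IU by (auto simp: D_def)
  have cD: "2 * card I + card D = 2 * k + 2"
  proof -
    have "card A0 + card B0 = card U + card I" using card_Un_Int[OF fin] IU by simp
    moreover have "finite U" "I \<subseteq> U" using IU fin by auto
    then have "card U = card I + card D"
      using card_mono[of U I] finI by (simp add: D_def card_Diff_subset)
    ultimately show ?thesis using c0 by simp
  qed
  let ?F = "\<lambda>t. {X \<in> bicolorings G D. int (card X) - int (card (D - X)) = t}"
  have finF: "finite (?F t)" for t using finite_bicolorings[OF finD, of G] by simp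
  have "card (fiber k (k + 2) I U) \<le> card (?F (-2))"
  proof (rule card_inj_on_le[of "\<lambda>(A, B). A - I", OF _ _ finF])
    show "inj_on (\<lambda>(A, B). A - I) (fiber k (k + 2) I U)"
      by (auto simp: inj_on_def fiber_def)
    show "(\<lambda>(A, B). A - I) ` fiber k (k + 2) I U \<subseteq> ?F (-2)"
    proof clarify
      fix A B assume "(A, B) \<in> fiber k (k + 2) I U"
      then have AB: "stable_set G A" "stable_set G B" "card A = k" "card B = k + 2"
        "A \<inter> B = I" "A \<union> B = U" by (auto simp: fiber_def stable_pairs_def)
      have DA: "D - (A - I) = B - I" using AB by (auto simp: D_def)
      have "finite A" "finite B" "I \<subseteq> A" "I \<subseteq> B"
        using AB finite_stable_set[OF G] by auto
      then have "card (A - I) = card A - card I" "card I \<le> card A"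
        "card (B - I) = card B - card I" "card I \<le> card B"
        using finI by (auto simp: card_Diff_subset card_mono)
      then have "int (card (A - I)) - int (card (B - I)) = -2" using AB by simp
      moreover have "A - I \<in> bicolorings G D"
        using AB DA by (auto simp: bicolorings_def D_def intro: stable_set_subset)
      ultimately show "A - I \<in> bicolorings G D \<and> int (card (A - I)) - int (card (D - (A - I))) = -2"
        using DA by simp
    qed
  qed
  also have "\<dots> \<le> card (?F 0)"
    using num_bicolorings_unimodal[OF G cf finD, of 0] num_bicolorings_uminus[of G D 2]
    by (simp add: num_bicolorings_def)
  also have "\<dots> \<le> card (fiber (k + 1) (k + 1) I U)"
  proof (rule card_inj_on_le[of "\<lambda>X. (I \<union> X, I \<union> (D - X))"])
    show "inj_on (\<lambda>X. (I \<union> X, I \<union> (D - X))) (?F 0)"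
      by (auto simp: inj_on_def bicolorings_def D_def)
    show "finite (fiber (k + 1) (k + 1) I U)"
      using finite_stable_pairs[OF G] by (rule finite_subset[rotated]) (auto simp: fiber_def)
    \<comment> \<open>Each vertex of \<open>Y\<close> lies with all of \<open>I\<close> in one of the stable sets \<open>A0\<close> and \<open>B0\<close>.\<close>
    have ext: "stable_set G (I \<union> Y)" if "stable_set G Y" "Y \<subseteq> D" for Y
      using that st0 IU unfolding stable_set_def D_def
      by (smt (verit) Diff_iff Int_iff Un_iff subset_iff)
    have cext: "card (I \<union> Y) = card I + card Y" if "Y \<subseteq> D" for Y
      using that finI finD by (intro card_Un_disjoint) (auto simp: D_def intro: finite_subset)
    show "(\<lambda>X. (I \<union> X, I \<union> (D - X))) ` ?F 0 \<subseteq> fiber (k + 1) (k + 1) I U"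
    proof clarify
      fix X assume X: "X \<in> bicolorings G D" "int (card X) - int (card (D - X)) = 0"
      then have XD: "X \<subseteq> D" "stable_set G X" "stable_set G (D - X)"
        by (auto simp: bicolorings_def)
      have "card X + card (D - X) = card D"
        using XD finD by (simp add: card_Diff_subset card_mono finite_subset)
      then have "card (I \<union> X) = k + 1" "card (I \<union> (D - X)) = k + 1"
        using X cD cext[OF XD(1)] cext[of "D - X"] by auto
      then show "(I \<union> X, I \<union> (D - X)) \<in> fiber (k + 1) (k + 1) I U"
        using ext XD IU by (auto simp: fiber_def stable_pairs_def D_def)
    qed
  qed
  finally show ?thesis .
qed simp

text \<open>
  Both products count pairs of stable sets; sort the pairs by intersection and union and compare
  the classes one by one.
\<close>

theorem claw_free_log_concave:
  assumes G: "finite_graph G" and cf: "claw_free G"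
  shows "num_stable G k * num_stable G (k + 2) \<le> (num_stable G (k + 1))\<^sup>2"
proof -
  let ?h = "\<lambda>(A, B). (A \<inter> B, A \<union> B)" and ?T = "Pow (verts G) \<times> Pow (verts G)"
  have count: "card (stable_pairs G i j)
      = (\<Sum>(I, U)\<in>?T. card {(A, B) \<in> stable_pairs G i j. A \<inter> B = I \<and> A \<union> B = U})" for i j
  proof -
    have "(\<Sum>q\<in>?T. \<Sum>p\<in>{p \<in> stable_pairs G i j. ?h p = q}. 1) = (\<Sum>p\<in>stable_pairs G i j. 1::nat)"
      by (rule sum.group) (use G finite_stable_pairs[OF G] in
          \<open>auto simp: finite_graph_def stable_pairs_def stable_set_def\<close>)
    moreover have "{p \<in> stable_pairs G i j. ?h p = (I, U)}
        = {(A, B) \<in> stable_pairs G i j. A \<inter> B = I \<and> A \<union> B = U}" for I U by auto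
    ultimately show ?thesis by (auto simp: case_prod_unfold prod_eq_iff)
  qed
  have "card (stable_pairs G k (k + 2)) \<le> card (stable_pairs G (k + 1) (k + 1))"
    unfolding count using card_stable_pairs_fiber_le[OF G cf]
    by (intro sum_mono) (auto simp: case_prod_unfold)
  then show ?thesis by (simp add: card_stable_pairs power2_eq_square)
qed

corollary claw_free_unimodal:
  "finite_graph G \<Longrightarrow> claw_free G \<Longrightarrow> unimodal (indep_poly G)"
  by (intro unimodal_indep_poly_if_log_concave claw_free_log_concave)

section \<open>Moving a pendant edge\<close>

lemma indep_poly_eqI:
  assumes bij: "bij_betw \<phi> {S. stable_set G S} {S. stable_set H S}"
    and card: "\<And>S. card (\<phi> S) = card S"
  shows "indep_poly G = indep_poly H"
proof -
  have img: "{S. stable_set H S} = \<phi> ` {S. stable_set G S}"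
    using bij by (simp add: bij_betw_def)
  have "num_stable G k = num_stable H k" for k
  proof -
    have "bij_betw \<phi> {S. stable_set G S \<and> card S = k} {S. stable_set H S \<and> card S = k}"
      unfolding bij_betw_def
    proof
      show "inj_on \<phi> {S. stable_set G S \<and> card S = k}"
        using bij by (auto simp: bij_betw_def elim: inj_on_subset)
      have "\<phi> ` {S. stable_set G S \<and> card S = k} = {T \<in> \<phi> ` {S. stable_set G S}. card T = k}"
        using card by auto
      also have "\<dots> = {S. stable_set H S \<and> card S = k}"
        unfolding img[symmetric] by simp
      finally show "\<phi> ` {S. stable_set G S \<and> card S = k} = {S. stable_set H S \<and> card S = k}" .
    qed
    then show ?thesis by (simp add: num_stable_def bij_betw_same_card)
  qed
  moreover have "{card S | S. stable_set G S} = {card S | S. stable_set H S}"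
    unfolding setcompr_eq_image img by (simp add: image_image card)
  ultimately show ?thesis by (simp add: indep_poly_def stability_number_def)
qed

text \<open>
  In \<open>K\<close>, let \<open>d\<close> be pendant at \<open>c\<close>, let \<open>a\<close> have no neighbor except possibly \<open>b\<close>, and let \<open>bc\<close> be
  an edge. Given that \<open>c\<close> belongs to a stable set, \<open>b\<close> does not, so of all constraints on \<open>a\<close> and
  \<open>d\<close> only that from \<open>c\<close> is left: it excludes \<open>d\<close> before the change and \<open>a\<close> after it. Swapping \<open>a\<close>
  and \<open>d\<close> translates between the two.
\<close>

lemma indep_poly_move_pendant:
  assumes verts: "a \<in> verts K" "d \<in> verts K" and dist: "distinct [a, b, c, d]"
    and bc: "{b, c} \<in> edges K" and cd: "{c, d} \<in> edges K"
    and a: "\<And>e. e \<in> edges K \<Longrightarrow> a \<in> e \<Longrightarrow> e = {a, b}"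
    and d: "\<And>e. e \<in> edges K \<Longrightarrow> d \<in> e \<Longrightarrow> e = {c, d}"
  shows "indep_poly K = indep_poly (verts K, (edges K \<union> {{a, c}}) - {{c, d}})"
    (is "_ = indep_poly ?K'")
proof (rule indep_poly_eqI)
  define \<sigma> where "\<sigma> = Transposition.transpose a d"
  define \<phi> where "\<phi> S = (if c \<in> S then \<sigma> ` S else S)" for S
  have [simp]: "a \<noteq> b" "a \<noteq> c" "a \<noteq> d" "b \<noteq> c" "b \<noteq> d" "c \<noteq> d"
      "b \<noteq> a" "c \<noteq> a" "d \<noteq> a" "c \<noteq> b" "d \<noteq> b" "d \<noteq> c" using dist by auto
  show "card (\<phi> S) = card S" for S
    by (simp add: \<phi>_def \<sigma>_def card_image)
  show "bij_betw \<phi> {S. stable_set K S} {S. stable_set ?K' S}"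
  proof (rule bij_betw_byWitness[where f' = \<phi>])
    have \<sigma>_mem: "x \<in> \<sigma> ` S \<longleftrightarrow> \<sigma> x \<in> S" for x S
      unfolding \<sigma>_def by (metis image_iff transpose_involutory)
    have mem: "x \<in> \<phi> S \<longleftrightarrow> (if c \<in> S then \<sigma> x \<in> S else x \<in> S)" for x S
      by (simp add: \<phi>_def \<sigma>_mem)
    have [simp]: "\<sigma> a = d" "\<sigma> d = a" "\<sigma> c = c" "\<sigma> b = b"
      by (simp_all add: \<sigma>_def)
    have other: "\<sigma> x = x" if "x \<noteq> a" "x \<noteq> d" for x
      using that by (simp add: \<sigma>_def)
    have "\<phi> (\<phi> S) = S" for S
      by (rule set_eqI) (simp add: mem \<sigma>_def)
    then show "\<forall>S\<in>{S. stable_set K S}. \<phi> (\<phi> S) = S"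
      "\<forall>S\<in>{S. stable_set ?K' S}. \<phi> (\<phi> S) = S" by auto
    have sub: "\<phi> S \<subseteq> verts K" if "S \<subseteq> verts K" for S
    proof
      fix x assume "x \<in> \<phi> S"
      then show "x \<in> verts K"
        using that verts other[of x] by (cases "x = a \<or> x = d") (auto simp: mem split: if_splits)
    qed
    show "\<phi> ` {S. stable_set K S} \<subseteq> {S. stable_set ?K' S}"
    proof clarify
      fix S assume S: "stable_set K S"
      have "{u, v} \<notin> edges ?K'" if uv: "u \<in> \<phi> S" "v \<in> \<phi> S" "u \<noteq> v" for u v
      proof
        assume e: "{u, v} \<in> edges ?K'"
        show False
        proof (cases "c \<in> S")
          case True
          then have "d \<notin> S" using stable_setD[OF S, of c d] cd by auto
          then have "a \<notin> \<phi> S" using True by (simp add: mem)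
          then have "u \<noteq> a" "v \<noteq> a" using uv by auto
          then have e': "{u, v} \<in> edges K" "{u, v} \<noteq> {c, d}"
            using e by (auto simp: doubleton_eq_iff)
          then have "u \<noteq> d" "v \<noteq> d" using d by auto
          then have "u \<in> S" "v \<in> S"
            using uv other True \<open>u \<noteq> a\<close> \<open>v \<noteq> a\<close> by (auto simp: mem)
          then show False using stable_setD[OF S] e' uv by blast
        next
          case False
          then have "u \<in> S" "v \<in> S" "u \<noteq> c" "v \<noteq> c" using uv by (auto simp: mem)
          then show False using stable_setD[OF S] e uv by (auto simp: doubleton_eq_iff)
        qed
      qed
      then show "stable_set ?K' (\<phi> S)"
        using sub S by (simp add: stable_set_def)
    qed
    show "\<phi> ` {S. stable_set ?K' S} \<subseteq> {S. stable_set K S}"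
    proof clarify
      fix S assume S: "stable_set ?K' S"
      have ac': "{a, c} \<in> edges ?K'" and bc': "{b, c} \<in> edges ?K'"
        using bc by (auto simp: doubleton_eq_iff)
      have "{u, v} \<notin> edges K" if uv: "u \<in> \<phi> S" "v \<in> \<phi> S" "u \<noteq> v" for u v
      proof
        assume e: "{u, v} \<in> edges K"
        show False
        proof (cases "c \<in> S")
          case True
          then have "a \<notin> S" "b \<notin> S"
            using stable_setD[OF S, of a c] stable_setD[OF S, of b c] ac' bc' by auto
          then have "d \<notin> \<phi> S" "b \<notin> \<phi> S" using True by (auto simp: mem)
          then have "u \<noteq> d" "v \<noteq> d" "u \<noteq> b" "v \<noteq> b" using uv by auto
          moreover from this have "u \<noteq> a" "v \<noteq> a"
            using a[OF e] uv by (auto simp: doubleton_eq_iff)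
          ultimately have "u \<in> S" "v \<in> S" "{u, v} \<in> edges ?K'"
            using uv other True e by (auto simp: mem doubleton_eq_iff)
          then show False using stable_setD[OF S] uv by blast
        next
          case False
          then have "u \<in> S" "v \<in> S" "u \<noteq> c" "v \<noteq> c" using uv by (auto simp: mem)
          then show False using stable_setD[OF S] e uv by (auto simp: doubleton_eq_iff)
        qed
      qed
      then show "stable_set K (\<phi> S)"
        using sub S by (simp add: stable_set_def)
    qed
  qed
qed

section \<open>Replacing the path by a triangle\<close>

lemma simplicialI:
  assumes G: "finite_graph G" and v: "v \<in> verts G"
    and clique: "\<And>u w. u \<in> neighborhood G v \<Longrightarrow> w \<in> neighborhood G v \<Longrightarrow> u \<noteq> w \<Longrightarrow> {u, w} \<in> edges G"
  shows "simplicial G v"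
proof -
  let ?N = "neighborhood G v"
  have "{e \<in> edges G. e \<subseteq> ?N} = {{u, w} | u w. u \<in> ?N \<and> w \<in> ?N \<and> u \<noteq> w}"
  proof (intro equalityI subsetI)
    fix e assume e: "e \<in> {e \<in> edges G. e \<subseteq> ?N}"
    then have "card e = 2" using G by (auto simp: finite_graph_def)
    then obtain u w where "e = {u, w}" "u \<noteq> w" by (auto simp: card_2_iff)
    then show "e \<in> {{u, w} | u w. u \<in> ?N \<and> w \<in> ?N \<and> u \<noteq> w}" using e by blast
  qed (use clique in auto)
  then show ?thesis
    using v by (simp add: simplicial_def complete_graph_def induced_subgraph_def)
qed

text \<open>
  What the change of edges makes of the path.
\<close>

definition triangle_and_point :: "'a \<Rightarrow> 'a \<Rightarrow> 'a \<Rightarrow> 'a \<Rightarrow> 'a graph" where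
  "triangle_and_point a b c d = ({a, b, c, d}, {{a, b}, {b, c}, {a, c}})"

lemma triangle_and_point:
  assumes "distinct [a, b, c, d]"
  shows finite_graph_triangle_and_point: "finite_graph (triangle_and_point a b c d)"
    and claw_free_triangle_and_point: "claw_free (triangle_and_point a b c d)"
    and simplicial_triangle_and_point: "simplicial (triangle_and_point a b c d) b"
proof -
  let ?T = "triangle_and_point a b c d"
  show fin: "finite_graph ?T"
    using assms by (auto simp: finite_graph_def triangle_and_point_def)
  show "claw_free ?T"
  proof (rule claw_freeI)
    fix x S assume x: "x \<in> verts ?T" and S: "S \<subseteq> neighborhood ?T x"
    have "neighborhood ?T x \<subseteq> {a, b, c} - {x}"
      using assms by (auto simp: neighborhood_def triangle_and_point_def doubleton_eq_iff)
    moreover have "neighborhood ?T d = {}"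
      using assms by (auto simp: neighborhood_def triangle_and_point_def doubleton_eq_iff)
    ultimately have "S \<subseteq> {b, c} \<or> S \<subseteq> {a, c} \<or> S \<subseteq> {a, b}"
      using x S by (auto simp: triangle_and_point_def)
    moreover have "card {b, c} = 2" "card {a, c} = 2" "card {a, b} = 2" using assms by auto
    ultimately show "card S \<le> 2"
      by (metis card_mono finite.emptyI finite_insert)
  qed
  show "simplicial ?T b"
    by (rule simplicialI[OF fin])
       (use assms in \<open>auto simp: neighborhood_def triangle_and_point_def doubleton_eq_iff\<close>)
qed


theorem lemma2p5:
  fixes G1 G2 P4 L1 L2 G3 G H :: "'a graph"
    and v1 v2 a b c d :: 'a
  assumes "finite_graph G1" and "finite_graph G2"
    and "v1 \<in> verts G1" and "v2 \<in> verts G2"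
    and "distinct [a, b, c, d]"
    and "P4 = ({a, b, c, d}, {{a, b}, {b, c}, {c, d}})"
    and "verts G1 \<inter> verts G2 = {}"
    and "verts G1 \<inter> verts P4 = {}"
    and "verts G2 \<inter> verts P4 = {}"
    and "L1 = edge_join P4 b G1 v1"
    and "L2 = (verts L1, (edges L1 \<union> {{a, c}}) - {{c, d}})"
    and "G3 = edge_join G1 v1 P4 b"
    and "G = edge_join G3 c G2 v2"
    and "H = (verts G, (edges G \<union> {{a, c}}) - {{c, d}})"
  shows "(indep_poly L1 = indep_poly L2 \<and>
          (claw_free G1 \<and> simplicial G1 v1 \<longrightarrow> unimodal (indep_poly L1))) \<and>
         (indep_poly G = indep_poly H \<and>
          (claw_free G1 \<and> claw_free G2 \<and> simplicial G1 v1 \<and> simplicial G2 v2 \<longrightarrow>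
             unimodal (indep_poly G)))"
proof -
  note defs = assms(6,10,11,12,13,14)
  have dist: "a \<noteq> b" "a \<noteq> c" "a \<noteq> d" "b \<noteq> c" "b \<noteq> d" "c \<noteq> d" using assms(5) by auto
  have new: "a \<notin> verts G1" "b \<notin> verts G1" "c \<notin> verts G1" "d \<notin> verts G1"
    "a \<notin> verts G2" "b \<notin> verts G2" "c \<notin> verts G2" "d \<notin> verts G2"
    using assms(6,8,9) by auto
  have neq: "v1 \<noteq> a" "v1 \<noteq> b" "v1 \<noteq> c" "v1 \<noteq> d" "v2 \<noteq> a" "v2 \<noteq> b" "v2 \<noteq> c" "v2 \<noteq> d"
    using new assms(3,4) by auto
  have E1: "e \<subseteq> verts G1" if "e \<in> edges G1" for e
    using assms(1) that by (simp add: finite_graph_def)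
  have E2: "e \<subseteq> verts G2" if "e \<in> edges G2" for e
    using assms(2) that by (simp add: finite_graph_def)
  have cd: "{c, d} \<notin> edges G1" "{c, d} \<notin> edges G2"
    using E1[of "{c, d}"] E2[of "{c, d}"] new by auto
  let ?T = "triangle_and_point a b c d"
  have L1_poly: "indep_poly L1 = indep_poly L2"
    unfolding assms(11)
  proof (rule indep_poly_move_pendant[OF _ _ assms(5)])
    show "e = {a, b}" if "e \<in> edges L1" "a \<in> e" for e
      using that new neq dist E1 by (auto simp: defs edge_join_def)
    show "e = {c, d}" if "e \<in> edges L1" "d \<in> e" for e
      using that new neq dist E1 by (auto simp: defs edge_join_def)
  qed (auto simp: defs edge_join_def)
  have G_poly: "indep_poly G = indep_poly H"
    unfolding assms(14)
  proof (rule indep_poly_move_pendant[OF _ _ assms(5)])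
    show "e = {a, b}" if "e \<in> edges G" "a \<in> e" for e
      using that new neq dist E1 E2 by (auto simp: defs edge_join_def)
    show "e = {c, d}" if "e \<in> edges G" "d \<in> e" for e
      using that new neq dist E1 E2 by (auto simp: defs edge_join_def)
  qed (auto simp: defs edge_join_def)
  \<comment> \<open>The change of edges happens inside the path, so it commutes with attaching \<open>G1\<close> and \<open>G2\<close>.\<close>
  have L2: "L2 = edge_join ?T b G1 v1"
    using cd dist neq
    by (auto simp: defs edge_join_def triangle_and_point_def doubleton_eq_iff)
  have H: "H = edge_join L2 c G2 v2"
    using cd dist neq
    by (auto simp: defs edge_join_def doubleton_eq_iff)
  have T_verts: "verts ?T = verts P4" by (simp add: assms(6) triangle_and_point_def)
  have fin_L2: "finite_graph L2"
    unfolding L2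
    using finite_graph_edge_join[OF finite_graph_triangle_and_point[OF assms(5)] assms(1) _ assms(3)]
      T_verts assms(6,8) by auto
  have L2_verts: "verts L2 = verts P4 \<union> verts G1"
    using T_verts by (simp add: L2 edge_join_def)
  have fin_H: "finite_graph H"
    unfolding H using finite_graph_edge_join[OF fin_L2 assms(2) _ assms(4)]
      L2_verts assms(6,7,9) by auto
  have cf_L2: "claw_free L2" if "claw_free G1" "simplicial G1 v1"
    unfolding L2
    by (rule claw_free_edge_join[OF finite_graph_triangle_and_point[OF assms(5)]
          claw_free_triangle_and_point[OF assms(5)] simplicial_triangle_and_point[OF assms(5)]
          assms(1) that]) (use T_verts assms(8) in auto)
  \<comment> \<open>The edge from \<open>b\<close> to \<open>v1\<close> leaves the neighborhood \<open>{a, b}\<close> of \<open>c\<close> as it was, a clique.\<close>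
  have simp_c: "simplicial L2 c"
  proof (rule simplicialI[OF fin_L2])
    show "c \<in> verts L2" using L2_verts assms(6) by simp
    have nb: "neighborhood L2 c \<subseteq> {a, b}"
      using E1 new dist neq
      by (auto simp: neighborhood_def L2 edge_join_def triangle_and_point_def doubleton_eq_iff)
    have ab: "{a, b} \<in> edges L2"
      by (simp add: L2 edge_join_def triangle_and_point_def)
    show "{u, w} \<in> edges L2"
      if "u \<in> neighborhood L2 c" "w \<in> neighborhood L2 c" "u \<noteq> w" for u w
    proof -
      have "{u, w} = {a, b}" using that nb by blast
      then show ?thesis using ab by simp
    qed
  qed
  have cf_H: "claw_free H"
    if "claw_free G1" "simplicial G1 v1" "claw_free G2" "simplicial G2 v2"
    unfolding H
    by (rule claw_free_edge_join[OF fin_L2 cf_L2[OF that(1,2)] simp_c assms(2) that(3,4)])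
       (use L2_verts assms(7,9) in auto)
  show ?thesis
    using L1_poly G_poly claw_free_unimodal[OF fin_L2 cf_L2] claw_free_unimodal[OF fin_H cf_H]
    by auto
qed

end
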